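(* Let $F$ be a field with $\mathrm{char}(F)\neq 2$, let $L$ be a Lie algebra over $F$ with derived algebra $L'=[L,L]$, and let $M$ be an $L$-module. If $\delta:L\times L\to M$ is a skew-symmetric biderivation, then $$\delta(u,[x,y])-u\cdot\delta(x,y)\in Z_M(L')\quad\text{for all } u,x,y\in L.$$
   Context: The action of $x\in L$ on $v\in M$ is written $x\cdot v$. A skew-symmetric biderivation $\delta:L\times L\to M$ is an $F$-bilinear map such that $\delta(x,y)=-\delta(y,x)$ for all $x,y\in L$ and $\delta([x,y],z)=x\cdot\delta(y,z)-y\cdot\delta(x,z)$ for all $x,y,z\in L$. For a subset $S\subseteq L$, $Z_M(S)=\{v\in M : s\cdot v=0 \text{ for all } s\in S\}$. *)

theory Defs
  imports Complex_Main
begin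

definition bilinear_over ::
  "('f::field \<Rightarrow> 'a::ab_group_add \<Rightarrow> 'a) \<Rightarrow> ('f \<Rightarrow> 'b::ab_group_add \<Rightarrow> 'b) \<Rightarrow>
   ('f \<Rightarrow> 'c::ab_group_add \<Rightarrow> 'c) \<Rightarrow> ('a \<Rightarrow> 'b \<Rightarrow> 'c) \<Rightarrow> bool"
  where "bilinear_over sa sb sc h \<longleftrightarrow>
    (\<forall>x. Vector_Spaces.linear sb sc (\<lambda>y. h x y)) \<and>
    (\<forall>y. Vector_Spaces.linear sa sc (\<lambda>x. h x y))"

locale lie_algebra = vector_space scale
  for scale :: "'f::field \<Rightarrow> 'l::ab_group_add \<Rightarrow> 'l" +
  fixes bracket :: "'l \<Rightarrow> 'l \<Rightarrow> 'l"
  assumes bracket_bilinear: "bilinear_over scale scale scale bracket"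
    and bracket_self: "bracket x x = 0"
    and jacobi: "bracket x (bracket y z) + bracket y (bracket z x) + bracket z (bracket x y) = 0"
begin

(* [L, L] is the linear span of the brackets, not merely the set of brackets. *)
definition derived_algebra :: "'l set"
  where "derived_algebra = span {bracket x y | x y. True}"

end

locale lie_module = lie_algebra scaleL bracket + M: vector_space scaleM
  for scaleL :: "'f::field \<Rightarrow> 'l::ab_group_add \<Rightarrow> 'l"
    and bracket :: "'l \<Rightarrow> 'l \<Rightarrow> 'l"
    and scaleM :: "'f \<Rightarrow> 'm::ab_group_add \<Rightarrow> 'm" +
  fixes act :: "'l \<Rightarrow> 'm \<Rightarrow> 'm"
  assumes act_bilinear: "bilinear_over scaleL scaleM scaleM act"
    and act_bracket: "act (bracket x y) v = act x (act y v) - act y (act x v)"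
begin

definition annihilated_by :: "'l set \<Rightarrow> 'm set"
  where "annihilated_by S = {v. \<forall>s\<in>S. act s v = 0}"

definition skew_biderivation :: "('l \<Rightarrow> 'l \<Rightarrow> 'm) \<Rightarrow> bool"
  where "skew_biderivation \<delta> \<longleftrightarrow>
    bilinear_over scaleL scaleL scaleM \<delta> \<and>
    (\<forall>x y. \<delta> x y = - \<delta> y x) \<and>
    (\<forall>x y z. \<delta> (bracket x y) z = act x (\<delta> y z) - act y (\<delta> x z))"

end

end

theory Submission
  imports Defs
begin

text \<open>
  Write \<open>P(a,b|c,d) = [a,b] \<cdot> \<delta>(c,d)\<close>. Expanding \<open>\<delta>([x,y],[u,v])\<close> in the first and in the second
  argument shows that \<open>P(x,u|y,v) + P(y,v|x,u)\<close> is invariant under exchanging \<open>u\<close> and \<open>v\<close>; being also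
  skew in \<open>x, u\<close> and in \<open>y, v\<close> it is twice zero, hence \<open>P(x,u|y,v) = - P(y,v|x,u)\<close>.

  The defect \<open>\<phi>(u,x,y) = \<delta>(u,[x,y]) - u \<cdot> \<delta>(x,y)\<close> is invariant under cyclic permutations, and
  \<open>T(a,b|u,x,y) = [a,b] \<cdot> \<phi>(u,x,y)\<close> changes sign under \<open>(a,b) \<leftrightarrow> (x,y)\<close>. These moves lead from
  any pair of the five letters to any disjoint pair, that is, along the edges of the Petersen
  graph, each at the cost of one sign. A 5-cycle of that graph gives \<open>T = - T\<close>.
\<close>

lemma (in vector_space) eq_0_if_eq_neg:
  fixes v :: 'b
  assumes "CHAR('a) \<noteq> 2" and "v = - v"
  shows "v = 0"
proof -
  have "\<not> CHAR('a) dvd 2"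
  proof
    assume dvd: "CHAR('a) dvd 2"
    then have "CHAR('a) \<le> 2" "CHAR('a) \<noteq> 0"
      by (auto intro: dvd_imp_le intro!: gr0I)
    with assms(1) have "CHAR('a) = 1" by linarith
    then show False by simp
  qed
  then have two: "(2 :: 'a) \<noteq> 0"
    using of_nat_eq_0_iff_char_dvd[of 2, where 'a = 'a] by simp
  have "v + v = 0"
    using assms(2) by (simp add: eq_neg_iff_add_eq_0)
  then have "scale 2 v = 0"
    using scale_left_distrib[of 1 1 v] by simp
  with two show ?thesis by simp
qed

lemma bilinear_over_arith:
  assumes "bilinear_over sa sb sc h"
  shows "h (x + x') y = h x y + h x' y" "h x (y + y') = h x y + h x y'"
    "h (x - x') y = h x y - h x' y" "h x (y - y') = h x y - h x y'"
    "h (- x) y = - h x y" "h x (- y) = - h x y"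
    "h 0 y = 0" "h x 0 = 0"
    "h (sa c x) y = sc c (h x y)" "h x (sb c y) = sc c (h x y)"
proof -
  have r: "module_hom sb sc (\<lambda>y. h x y)" and l: "module_hom sa sc (\<lambda>x. h x y)" for x y
    using assms by (auto simp: bilinear_over_def linear_iff_module_hom)
  show "h (x + x') y = h x y + h x' y" "h (x - x') y = h x y - h x' y"
    "h (- x) y = - h x y" "h 0 y = 0" "h (sa c x) y = sc c (h x y)"
    by (rule module_hom.add[OF l] module_hom.diff[OF l] module_hom.neg[OF l]
        module_hom.zero[OF l] module_hom.scale[OF l])+
  show "h x (y + y') = h x y + h x y'" "h x (y - y') = h x y - h x y'"
    "h x (- y) = - h x y" "h x 0 = 0" "h x (sb c y) = sc c (h x y)"
    by (rule module_hom.add[OF r] module_hom.diff[OF r] module_hom.neg[OF r]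
        module_hom.zero[OF r] module_hom.scale[OF r])+
qed

lemma (in lie_algebra) bracket_skew: "bracket y x = - bracket x y"
proof -
  have "bracket (x + y) (x + y) = bracket y x + bracket x y"
    unfolding bilinear_over_arith[OF bracket_bilinear] by (simp add: bracket_self)
  then show ?thesis
    unfolding bracket_self eq_neg_iff_add_eq_0 by (rule sym)
qed

context lie_module
begin

lemmas act_arith = bilinear_over_arith[OF act_bilinear]

text \<open>The action is linear in its first argument, so vanishing on the brackets carries over to
  their span.\<close>

lemma annihilated_by_derived_algebraI:
  assumes "\<And>a b. act (bracket a b) v = 0"
  shows "v \<in> annihilated_by derived_algebra"
proof -
  have "act s v = 0" if "s \<in> derived_algebra" for s
    using that unfolding derived_algebra_def
    by (induction rule: span_induct_alt) (auto simp: act_arith assms)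
  then show ?thesis by (simp add: annihilated_by_def)
qed

context
  fixes \<delta> :: "'l \<Rightarrow> 'l \<Rightarrow> 'm"
  assumes biderivation: "skew_biderivation \<delta>"
begin

lemma skew: "\<delta> y x = - \<delta> x y"
  using biderivation unfolding skew_biderivation_def by blast

lemma derivation_left: "\<delta> (bracket x y) z = act x (\<delta> y z) - act y (\<delta> x z)"
  using biderivation unfolding skew_biderivation_def by blast

lemma derivation_right: "\<delta> z (bracket x y) = act x (\<delta> z y) - act y (\<delta> z x)"
  using derivation_left[of x y z] skew[of z] by (simp add: act_arith)

lemma act_bracket_biderivation_swap:
  assumes "CHAR('f) \<noteq> 2"
  shows "act (bracket x u) (\<delta> y v) = - act (bracket y v) (\<delta> x u)"
proof -
  define S where "S x u y v = act (bracket x u) (\<delta> y v) + act (bracket y v) (\<delta> x u)" for x u y v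
  have exchange: "S x u y v = S x v y u" for x u y v
  proof -
    \<comment> \<open>Both sides are \<open>\<delta> (bracket x y) (bracket u v)\<close>: on the
      left the first argument is opened, on the right the second.\<close>
    have "act x (\<delta> y (bracket u v)) - act y (\<delta> x (bracket u v))
        = act u (\<delta> (bracket x y) v) - act v (\<delta> (bracket x y) u)"
      using derivation_left[of x y "bracket u v"] derivation_right[of "bracket x y" u v] by simp
    then show ?thesis
      unfolding derivation_left derivation_right S_def act_bracket act_arith
      by (simp add: algebra_simps)
  qed
  have skew12: "S u x y v = - S x u y v" and skew34: "S x u v y = - S x u y v" for x u y v
    by (simp_all add: S_def bracket_skew[of x u] bracket_skew[of y v] skew[of x u] skew[of y v]
        act_arith)
  \<comment> \<open>Conjugated by \<open>skew12\<close>, \<open>exchange\<close> shows that swapping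
    slots 1 and 4 fixes \<open>S\<close>. With the swap of slots 2 and 4 this generates the swap of
    slots 1 and 2, which by \<open>skew12\<close> negates \<open>S\<close>.\<close>
  have "S x u y v = - S x u y v"
    using exchange skew12 skew34 by metis
  then have "S x u y v = 0"
    by (rule M.eq_0_if_eq_neg[OF assms])
  then show ?thesis
    by (simp add: S_def eq_neg_iff_add_eq_0)
qed

definition defect :: "'l \<Rightarrow> 'l \<Rightarrow> 'l \<Rightarrow> 'm"
  where "defect u x y = \<delta> u (bracket x y) - act u (\<delta> x y)"

text \<open>Opening the bracket turns the defect into minus the cyclic sum of
  \<open>act u (\<delta> x y)\<close>.\<close>

lemma defect_cyclic: "defect u x y = defect x y u"
  by (simp add: defect_def derivation_right skew[of u y] skew[of u x] skew[of x y] act_arith)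

lemma act_bracket_defect_swap:
  assumes "CHAR('f) \<noteq> 2"
  shows "act (bracket a b) (defect u x y) = - act (bracket x y) (defect u a b)"
proof -
  note swap = act_bracket_biderivation_swap[OF assms]
  have "act (bracket a b) (defect u x y)
      = - act (bracket u (bracket x y)) (\<delta> a b) - act (bracket a b) (act u (\<delta> x y))"
    by (simp add: defect_def act_arith swap[of a b u "bracket x y"])
  \<comment> \<open>The outer bracket with \<open>u\<close> is split into a commutator, the inner
    term changes by \<open>swap[of x y a b]\<close>, and the result regroups as a commutator of
    \<open>u\<close> with \<open>bracket a b\<close>.\<close>
  also have "\<dots> = act (bracket u (bracket a b)) (\<delta> x y) + act (bracket x y) (act u (\<delta> a b))"
    using act_bracket[of u "bracket x y" "\<delta> a b"] act_bracket[of u "bracket a b" "\<delta> x y"]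
    by (simp add: act_arith swap[of x y a b])
  also have "\<dots> = - act (bracket x y) (defect u a b)"
    by (simp add: defect_def act_arith swap[of x y u "bracket a b"])
  finally show ?thesis .
qed

lemma act_bracket_defect:
  assumes "CHAR('f) \<noteq> 2"
  shows "act (bracket a b) (defect u x y) = 0"
proof -
  define T where "T a b u x y = act (bracket a b) (defect u x y)" for a b u x y
  have swap: "T a b u x y = - T x y u a b" for a b u x y
    unfolding T_def by (rule act_bracket_defect_swap[OF assms])
  have cyclic: "T a b u x y = T a b x y u" for a b u x y
    unfolding T_def by (subst defect_cyclic) (rule refl)
  \<comment> \<open>The leading pair runs through {a,b}, {x,y}, {u,a}, {b,x}, {y,u} and back to
    {a,b}. Rotations bring the next pair into the last two slots; the five swaps leave a minus
    sign.\<close>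
  have "T a b u x y = - T x y b u a"
    using swap[of a b u x y] cyclic[of x y b u a] by simp
  also have "\<dots> = T u a y b x"
    using swap[of x y b u a] cyclic[of u a y b x] by simp
  also have "\<dots> = - T b x a y u"
    using swap[of u a y b x] cyclic[of b x a y u] cyclic[of b x y u a] by simp
  also have "\<dots> = T y u x a b"
    using swap[of b x a y u] cyclic[of y u x a b] by simp
  also have "\<dots> = - T a b u x y"
    using swap[of y u x a b] cyclic[of a b u x y] by simp
  finally show ?thesis
    unfolding T_def by (rule M.eq_0_if_eq_neg[OF assms])
qed

end

end

theorem lemma2p1:
  fixes scaleL :: "'f::field \<Rightarrow> 'l::ab_group_add \<Rightarrow> 'l"
    and bracket :: "'l \<Rightarrow> 'l \<Rightarrow> 'l"
    and scaleM :: "'f \<Rightarrow> 'm::ab_group_add \<Rightarrow> 'm"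
    and act :: "'l \<Rightarrow> 'm \<Rightarrow> 'm"
    and \<delta> :: "'l \<Rightarrow> 'l \<Rightarrow> 'm"
  assumes "CHAR('f) \<noteq> 2"
    and "lie_algebra scaleL bracket"
    and "lie_module scaleL bracket scaleM act"
    and "lie_module.skew_biderivation scaleL bracket scaleM act \<delta>"
  shows "\<forall>u x y. \<delta> u (bracket x y) - act u (\<delta> x y) \<in>
    lie_module.annihilated_by act (lie_algebra.derived_algebra scaleL bracket)"
proof -
  interpret lie_module scaleL bracket scaleM act by fact
  show ?thesis
    using act_bracket_defect[OF assms(4,1)]
    by (auto intro!: annihilated_by_derived_algebraI simp: defect_def[OF assms(4)])
qed

end
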